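(* Let $m\ge2$ be the degree of the splines and let $p\ge m$ be an integer. Assume that the sequence of knots $T$ satisfies, for all $i\in\mathbb{Z}$, $$\theta_{i-1}+\theta_i\le\theta_{i-p}+\theta_{i+p}\le\theta_i+\theta_{i+1}.$$ Then, for all $i\in\mathbb{Z}$, the vector $\lambda_i^*\in\mathbb{R}^{2p+1}$ (defined in the context) is an optimal solution of the local minimization problem $$\min\Big\{\|\lambda_i\|_1=\sum_{s=-p}^p|\lambda_i(s)| : \lambda_i\in\mathbb{R}^{2p+1},\ \sum_{s=-p}^p\lambda_i(s)\,\theta_{i+s}^{\,r}=\theta_i^{(r)}\ \text{for } r=0,1,2\Big\}.$$ Thus the spline discrete quasi-interpolant $Q_{p,2}^*$ is near-best, and its infinite norm satisfies $\|Q_{p,2}^*\|_\infty\le\frac{m+1}{m-1}$, a bound independent of $p$ and of the sequence of knots $T$.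
   Context: Let $T=\{t_i\}_{i\in\mathbb{Z}}$ be a strictly increasing sequence of knots partitioning $\mathbb{R}$ (so $t_i\to\pm\infty$ as $i\to\pm\infty$). For $i\in\mathbb{Z}$, $B_i$ is the B-spline of degree $m$ with support $[t_{i-m},t_{i+1}]$, i.e. with knots $t_{i-m},\dots,t_{i+1}$, normalized so that $\sum_{i\in\mathbb{Z}}B_i=1$. Let $\theta_i^{(0)}=1$, $\theta_i^{(1)}=\theta_i=\frac1m\sum_{r=0}^{m-1}t_{i-r}$ and $\theta_i^{(2)}=\binom m2^{-1}\sum_{0\le r<s\le m-1}t_{i-r}t_{i-s}$; $\theta_{i+s}^{\,r}$ is the ordinary $r$-th power of $\theta_{i+s}$. For $i\in\mathbb{Z}$ let $(\lambda_i^*(-p),\lambda_i^*(0),\lambda_i^*(p))$ be the unique solution of the $3\times3$ Vandermonde system $$\lambda_i^*(-p)+\lambda_i^*(0)+\lambda_i^*(p)=1,$$ $$\theta_{i-p}\lambda_i^*(-p)+\theta_i\lambda_i^*(0)+\theta_{i+p}\lambda_i^*(p)=\theta_i,$$ $$\theta_{i-p}^2\lambda_i^*(-p)+\theta_i^2\lambda_i^*(0)+\theta_{i+p}^2\lambda_i^*(p)=\theta_i^{(2)},$$ and let $\lambda_i^*=(\lambda_i^*(s))_{-p\le s\le p}\in\mathbb{R}^{2p+1}$ be the vector with these entries at $s=-p,0,p$ and $\lambda_i^*(s)=0$ for all other $s$. The operator $Q_{p,2}^*$ is $$Q_{p,2}^*f=\sum_{i\in\mathbb{Z}}\mu_i^*(f)B_i,\qquad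 \mu_i^*(f)=\lambda_i^*(-p)f(\theta_{i-p})+\lambda_i^*(0)f(\theta_i)+\lambda_i^*(p)f(\theta_{i+p}).$$ A discrete quasi-interpolant $Qf=\sum_{i\in\mathbb{Z}}\big(\sum_{s=-p}^p\lambda_i(s)f(\theta_{i+s})\big)B_i$ exact on polynomials of degree at most $2$ is called near-best if, for every $i\in\mathbb{Z}$, its coefficient vector $\lambda_i$ is a solution of the minimization problem displayed in the claim. $\|Q\|_\infty$ denotes the operator norm with respect to the sup norm on $\mathbb{R}$, i.e. the supremum of $\|Qf\|_\infty$ over bounded continuous $f$ on $\mathbb{R}$ with $\|f\|_\infty\le1$. *)

theory Defs
  imports
    "HOL-Analysis.Analysis"
    "HOL-Computational_Algebra.Polynomial"
begin

text \<open>
  Throughout, \<open>t :: int \<Rightarrow> real\<close> is the knot sequence and \<open>m\<close> is the degree of the splines.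
  A vector of \<open>\<real>\<^bsup>2p+1\<^esup>\<close> is a function \<open>int \<Rightarrow> real\<close> that vanishes outside \<open>{-p..p}\<close>.
\<close>

definition theta :: "(int \<Rightarrow> real) \<Rightarrow> nat \<Rightarrow> int \<Rightarrow> real" where
  "theta t m i = (\<Sum>r<m. t (i - int r)) / real m"

text \<open>The normalized elementary symmetric mean; only \<open>r \<le> 2\<close> is meaningful.\<close>

definition theta_sym :: "(int \<Rightarrow> real) \<Rightarrow> nat \<Rightarrow> int \<Rightarrow> nat \<Rightarrow> real" where
  "theta_sym t m i r =
    (if r = 0 then 1
     else if r = 1 then theta t m i
     else (\<Sum>s<m. \<Sum>r<s. t (i - int r) * t (i - int s)) / real (m choose 2))"

text \<open>
  \<open>bspline t k i\<close> is the normalized B-spline of degree \<open>k\<close> with knots \<open>t (i - k), \<dots>, t (i + 1)\<close>,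
  given by the Cox--de Boor recursion (indexed by the last knot but one).
\<close>

fun bspline :: "(int \<Rightarrow> real) \<Rightarrow> nat \<Rightarrow> int \<Rightarrow> real \<Rightarrow> real" where
  "bspline t 0 i x = (if t i \<le> x \<and> x < t (i + 1) then 1 else 0)"
| "bspline t (Suc k) i x =
     (x - t (i - int (Suc k))) / (t i - t (i - int (Suc k))) * bspline t k (i - 1) x
   + (t (i + 1) - x) / (t (i + 1) - t (i - int k)) * bspline t k i x"

definition coeff_vectors :: "nat \<Rightarrow> (int \<Rightarrow> real) set" where
  "coeff_vectors p = {v. \<forall>s. s \<notin> {- int p..int p} \<longrightarrow> v s = 0}"

definition norm1 :: "nat \<Rightarrow> (int \<Rightarrow> real) \<Rightarrow> real" where
  "norm1 p v = (\<Sum>s = - int p..int p. \<bar>v s\<bar>)"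

definition feasible :: "(int \<Rightarrow> real) \<Rightarrow> nat \<Rightarrow> nat \<Rightarrow> int \<Rightarrow> (int \<Rightarrow> real) \<Rightarrow> bool" where
  "feasible t m p i v \<longleftrightarrow> v \<in> coeff_vectors p \<and>
    (\<forall>r\<in>{0, 1, 2}. (\<Sum>s = - int p..int p. v s * theta t m (i + s) ^ r) = theta_sym t m i r)"

definition local_optimal :: "(int \<Rightarrow> real) \<Rightarrow> nat \<Rightarrow> nat \<Rightarrow> int \<Rightarrow> (int \<Rightarrow> real) \<Rightarrow> bool" where
  "local_optimal t m p i v \<longleftrightarrow> is_arg_min (norm1 p) (feasible t m p i) v"

definition dqi ::
  "(int \<Rightarrow> real) \<Rightarrow> nat \<Rightarrow> nat \<Rightarrow> (int \<Rightarrow> int \<Rightarrow> real) \<Rightarrow> (real \<Rightarrow> real) \<Rightarrow> real \<Rightarrow> real" where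
  "dqi t m p lam f x =
    (\<Sum>\<^sub>\<infinity>i\<in>UNIV. (\<Sum>s = - int p..int p. lam i s * f (theta t m (i + s))) * bspline t m i x)"

definition exact_deg2 :: "((real \<Rightarrow> real) \<Rightarrow> real \<Rightarrow> real) \<Rightarrow> bool" where
  "exact_deg2 Q \<longleftrightarrow> (\<forall>q :: real poly. degree q \<le> 2 \<longrightarrow> Q (poly q) = poly q)"

text \<open>\<open>Q\<close> is a near-best discrete quasi-interpolant with coefficient vectors \<open>lam i\<close>.\<close>

definition near_best ::
  "(int \<Rightarrow> real) \<Rightarrow> nat \<Rightarrow> nat \<Rightarrow> (int \<Rightarrow> int \<Rightarrow> real) \<Rightarrow> ((real \<Rightarrow> real) \<Rightarrow> real \<Rightarrow> real) \<Rightarrow> bool" where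
  "near_best t m p lam Q \<longleftrightarrow>
    Q = dqi t m p lam \<and> exact_deg2 Q \<and> (\<forall>i. local_optimal t m p i (lam i))"

definition vandermonde_solution ::
  "(int \<Rightarrow> real) \<Rightarrow> nat \<Rightarrow> nat \<Rightarrow> int \<Rightarrow> (int \<Rightarrow> real) \<Rightarrow> bool" where
  "vandermonde_solution t m p i v \<longleftrightarrow>
    (\<forall>s. s \<notin> {- int p, 0, int p} \<longrightarrow> v s = 0) \<and>
    v (- int p) + v 0 + v (int p) = 1 \<and>
    theta t m (i - int p) * v (- int p) + theta t m i * v 0 + theta t m (i + int p) * v (int p)
      = theta t m i \<and>
    (theta t m (i - int p))\<^sup>2 * v (- int p) + (theta t m i)\<^sup>2 * v 0
      + (theta t m (i + int p))\<^sup>2 * v (int p) = theta_sym t m i 2"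

definition lambda_star :: "(int \<Rightarrow> real) \<Rightarrow> nat \<Rightarrow> nat \<Rightarrow> int \<Rightarrow> int \<Rightarrow> real" where
  "lambda_star t m p i = (THE v. vandermonde_solution t m p i v)"

definition mu_star :: "(int \<Rightarrow> real) \<Rightarrow> nat \<Rightarrow> nat \<Rightarrow> int \<Rightarrow> (real \<Rightarrow> real) \<Rightarrow> real" where
  "mu_star t m p i f =
     lambda_star t m p i (- int p) * f (theta t m (i - int p))
   + lambda_star t m p i 0 * f (theta t m i)
   + lambda_star t m p i (int p) * f (theta t m (i + int p))"

definition Q_star :: "(int \<Rightarrow> real) \<Rightarrow> nat \<Rightarrow> nat \<Rightarrow> (real \<Rightarrow> real) \<Rightarrow> real \<Rightarrow> real" where
  "Q_star t m p f x = (\<Sum>\<^sub>\<infinity>i\<in>UNIV. mu_star t m p i f * bspline t m i x)"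

text \<open>The norms take values in \<^typ>\<open>ereal\<close>, so the suprema below are always genuine.\<close>

definition sup_norm :: "(real \<Rightarrow> real) \<Rightarrow> ereal" where
  "sup_norm f = (SUP x. ereal \<bar>f x\<bar>)"

definition op_sup_norm :: "((real \<Rightarrow> real) \<Rightarrow> real \<Rightarrow> real) \<Rightarrow> ereal" where
  "op_sup_norm Q =
    (SUP f\<in>{f. continuous_on UNIV f \<and> bounded (range f) \<and> sup_norm f \<le> 1}. sup_norm (Q f))"


text \<open>The B-splines have the stated support and normalization.\<close>

lemma bspline_eq_0:
  assumes "strict_mono t" and "x < t (i - int k) \<or> t (i + 1) \<le> x"
  shows "bspline t k i x = 0"
  using assms(2)
proof (induction k arbitrary: i)
  case 0
  then show ?case by auto
next
  case (Suc k)
  have "t (i - int (Suc k)) < t (i - int k)" "t i < t (i + 1)"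
    using assms(1) by (auto simp: strict_mono_less)
  with Suc.prems have "x < t (i - int k) \<or> t (i + 1) \<le> x"
    and "x < t (i - 1 - int k) \<or> t (i - 1 + 1) \<le> x"
    by (auto simp: algebra_simps)
  with Suc.IH[of i] Suc.IH[of "i - 1"] show ?case by simp
qed

lemma bspline_finite_support:
  assumes t: "strict_mono t" "filterlim t at_top at_top" "filterlim t at_bot at_bot"
  shows "finite {i. bspline t k i x \<noteq> 0}"
proof -
  obtain a where a: "\<And>i. i \<ge> a \<Longrightarrow> x < t i"
    using filterlim_at_top_dense[THEN iffD1, OF t(2), rule_format, of x]
    by (auto simp: eventually_at_top_linorder)
  obtain b where b: "\<And>i. i \<le> b \<Longrightarrow> t i < x"
    using filterlim_at_bot_dense[THEN iffD1, OF t(3), rule_format, of x]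
    by (auto simp: eventually_at_bot_linorder)
  have "bspline t k i x = 0" if "i \<notin> {b..a + int k}" for i
  proof -
    have "x < t (i - int k) \<or> t (i + 1) \<le> x"
      using that a[of "i - int k"] b[of "i + 1"] by force
    then show ?thesis by (rule bspline_eq_0[OF t(1)])
  qed
  then have "{i. bspline t k i x \<noteq> 0} \<subseteq> {b..a + int k}" by blast
  then show ?thesis by (rule finite_subset) simp
qed

lemma bspline_partition_of_unity:
  assumes t: "strict_mono t" "filterlim t at_top at_top" "filterlim t at_bot at_bot"
  shows "((\<lambda>i. bspline t k i x) has_sum 1) UNIV"
proof (induction k)
  case 0
  obtain a where a: "\<And>i. i \<ge> a \<Longrightarrow> x < t i"
    using filterlim_at_top_dense[THEN iffD1, OF t(2), rule_format, of x]
    by (auto simp: eventually_at_top_linorder)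
  obtain b where b: "\<And>i. i \<le> b \<Longrightarrow> t i < x"
    using filterlim_at_bot_dense[THEN iffD1, OF t(3), rule_format, of x]
    by (auto simp: eventually_at_bot_linorder)
  define S where "S = {i. b \<le> i \<and> i \<le> a \<and> t i \<le> x}"
  have "S \<subseteq> {b..a}" by (auto simp: S_def)
  then have fin: "finite S" by (rule finite_subset) simp
  have "b < a" using a[of b] b[of b] by force
  then have "b \<in> S" using b[of b] by (simp add: S_def)
  then have j: "Max S \<in> S" using fin by (metis Max_in empty_iff)
  define j where "j = Max S"
  have le: "t j \<le> x" using j by (simp add: j_def S_def)
  have lt: "x < t (j + 1)"
  proof (rule ccontr)
    assume n: "\<not> x < t (j + 1)"
    then have "j + 1 \<le> a" using a[of "j + 1"] by linarith
    with n j have "j + 1 \<in> S" by (auto simp: S_def j_def)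
    with fin have "j + 1 \<le> j" unfolding j_def by (rule Max_ge)
    then show False by simp
  qed
  have "bspline t 0 i x = 0" if "i \<noteq> j" for i
  proof (cases "i < j")
    case True
    then have "t (i + 1) \<le> t j" using t(1) by (simp add: strict_mono_less_eq)
    with le show ?thesis by simp
  next
    case False
    then have "t (j + 1) \<le> t i" using t(1) that by (simp add: strict_mono_less_eq)
    with lt show ?thesis by simp
  qed
  then show ?case
    using le lt by (intro has_sum_finite_neutralI[where B = "{j}"]) auto
next
  case (Suc k)
  define F where
    "F i = (x - t (i - int k)) / (t (i + 1) - t (i - int k)) * bspline t k i x" for i
  have "F i = 0" if "i \<notin> {i. bspline t k i x \<noteq> 0}" for i using that by (simp add: F_def)
  then have F: "(F has_sum sum F {i. bspline t k i x \<noteq> 0}) UNIV"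
    using bspline_finite_support[OF t] by (intro has_sum_finite_neutralI) auto
  define c where "c = sum F {i. bspline t k i x \<noteq> 0}"
  have F': "((\<lambda>i. F (i - 1)) has_sum c) UNIV"
    using F has_sum_reindex_bij_witness[of UNIV "\<lambda>i. i + 1" "\<lambda>i. i - 1" UNIV F "\<lambda>i. F (i - 1)" c c]
    by (simp add: c_def)
  have "bspline t (Suc k) i x = F (i - 1) + (bspline t k i x + - F i)" for i
  proof -
    have "t (i - int k) < t (i + 1)" using t(1) by (simp add: strict_mono_less)
    then have right: "(t (i + 1) - x) / (t (i + 1) - t (i - int k))
        = 1 - (x - t (i - int k)) / (t (i + 1) - t (i - int k))"
      by (simp add: field_simps)
    have "i - 1 - int k = i - int (Suc k)" "i - 1 + 1 = i" by simp_all
    then have "bspline t (Suc k) i x = F (i - 1)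
        + (t (i + 1) - x) / (t (i + 1) - t (i - int k)) * bspline t k i x"
      by (simp only: F_def bspline.simps)
    then show ?thesis by (simp only: right F_def left_diff_distrib)
  qed
  moreover have "((\<lambda>i. F (i - 1) + (bspline t k i x + - F i)) has_sum (c + (1 + - c))) UNIV"
    using F F' Suc.IH
    by (intro has_sum_add) (auto simp: c_def has_sum_uminus)
  ultimately show ?case by simp
qed


text \<open>The Vandermonde system has exactly one solution, so \<^const>\<open>lambda_star\<close> is well defined.\<close>

lemma theta_strict_mono:
  assumes "strict_mono t" and "m > 0"
  shows "strict_mono (theta t m)"
proof (rule strict_monoI)
  fix i j :: int
  assume "i < j"
  then have "(\<Sum>r<m. t (i - int r)) < (\<Sum>r<m. t (j - int r))"
    using assms by (intro sum_strict_mono) (auto simp: strict_mono_less)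
  then show "theta t m i < theta t m j"
    using assms(2) by (simp add: theta_def divide_strict_right_mono)
qed

lemma vandermonde_solution_ex1:
  assumes "strict_mono t" and "m > 0" and "p > 0"
  shows "\<exists>!v. vandermonde_solution t m p i v"
proof -
  define x y z w where "x = theta t m (i - int p)" "y = theta t m i"
    "z = theta t m (i + int p)" "w = theta_sym t m i 2"
  note xyz = this
  have lt: "x < y" "y < z"
    using theta_strict_mono[OF assms(1,2)] assms(3) by (auto simp: xyz strict_mono_less)
  define a c where "a = (w - y\<^sup>2) / ((x - y) * (x - z))"
    and "c = (w - y\<^sup>2) / ((z - x) * (z - y))"
  have nz: "x - y \<noteq> 0" "x - z \<noteq> 0" "z - x \<noteq> 0" "z - y \<noteq> 0" using lt by auto
  have a: "a * ((x - y) * (x - z)) = w - y\<^sup>2" and c: "c * ((z - x) * (z - y)) = w - y\<^sup>2"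
    using nz by (simp_all add: a_def c_def)
  have lin: "x * a + y * (1 - a - c) + z * c = y"
  proof -
    have "(x - z) * (a * (x - y) + c * (z - y)) = 0" using a c by algebra
    with nz have "a * (x - y) + c * (z - y) = 0" by simp
    then show ?thesis by (simp add: algebra_simps)
  qed
  have quad: "x\<^sup>2 * a + y\<^sup>2 * (1 - a - c) + z\<^sup>2 * c = w"
  proof -
    have "x\<^sup>2 * a + y\<^sup>2 * (1 - a - c) + z\<^sup>2 * c - w
        = (z + y) * (x * a + y * (1 - a - c) + z * c - y) + (a * ((x - y) * (x - z)) - (w - y\<^sup>2))"
      by (simp add: algebra_simps power2_eq_square)
    with lin a show ?thesis by simp
  qed
  define v where "v s = (if s = - int p then a else if s = 0 then 1 - a - c
    else if s = int p then c else 0)" for s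
  have "vandermonde_solution t m p i v"
    using lin quad assms(3) by (auto simp: vandermonde_solution_def v_def xyz)
  moreover have "u = v'" if u: "vandermonde_solution t m p i u"
    and v: "vandermonde_solution t m p i v'" for u v'
  proof -
    define A B C where "A = u (- int p) - v' (- int p)" "B = u 0 - v' 0"
      "C = u (int p) - v' (int p)"
    note ABC = this
    have "A + B + C = 0" "x * A + y * B + z * C = 0" "x\<^sup>2 * A + y\<^sup>2 * B + z\<^sup>2 * C = 0"
      using u v unfolding vandermonde_solution_def xyz[symmetric] ABC
      by (simp_all add: algebra_simps)
    then have "A * ((x - y) * (x - z)) = 0" "C * ((z - x) * (z - y)) = 0" "A + B + C = 0"
      by algebra+
    with nz have "A = 0" "B = 0" "C = 0" by auto
    then have "u s = v' s" if "s \<in> {- int p, 0, int p}" for s using that by (auto simp: ABC)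
    moreover have "u s = v' s" if "s \<notin> {- int p, 0, int p}" for s
      using u v that by (simp add: vandermonde_solution_def)
    ultimately show ?thesis by blast
  qed
  ultimately show ?thesis by blast
qed

end

theory Submission
  imports Defs
begin

text \<open>
  Write \<open>x = \<theta>\<^bsub>i-p\<^esub>\<close>, \<open>y = \<theta>\<^bsub>i\<^esub>\<close>, \<open>z = \<theta>\<^bsub>i+p\<^esub>\<close>. Everything depends on the quantity
  \<open>d = y\<^sup>2 - \<theta>\<^sub>i\<^bsup>(2)\<^esup>\<close>, which is the variance of the \<open>m\<close> knots averaged by \<open>y\<close>, divided by \<open>m - 1\<close>
  (\<open>theta_square_minus_theta_sym\<close>).

  Optimality is linear programming duality. Since \<open>d \<ge> 0\<close>, the entries of \<open>\<lambda>*\<close> at \<open>-p, 0, p\<close> are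
  \<open>\<le> 0\<close>, \<open>\<ge> 0\<close>, \<open>\<le> 0\<close>. Let \<open>q\<close> be the quadratic polynomial with values \<open>-1, 1, -1\<close> at \<open>x, y, z\<close>. Pairing
  a feasible vector with \<open>q\<close> gives a value that depends only on the constraints; for \<open>\<lambda>*\<close> it is
  the \<open>l\<^sup>1\<close> norm, and for any other vector at most the norm of that vector, provided that \<open>\<bar>q\<bar> \<le> 1\<close> at all the
  nodes \<open>\<theta>\<^bsub>i+s\<^esub>\<close>. By concavity \<open>q \<ge> -1\<close> on \<open>[x, z]\<close>, while \<open>q > 1\<close> exactly at the points strictly between \<open>y\<close>
  and its reflection \<open>x + z - y\<close>. The hypothesis on the knots says that this reflection lies in
  \<open>[\<theta>\<^bsub>i-1\<^esub>, \<theta>\<^bsub>i+1\<^esub>]\<close>, so that no node lies in the bad interval (\<open>dual_quadratic_bounded\<close>,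
  \<open>norm1_le_by_duality\<close>).

  Exactness reduces to \<open>\<Sum>\<^sub>i \<theta>\<^sub>i\<^bsup>(r)\<^esup> B\<^sub>i(x) = x\<^sup>r\<close> for \<open>r \<le> 2\<close>. The elementary symmetric functions of
  the knots are affine in each knot, and one step of the Cox--de Boor recursion replaces one knot
  by \<open>x\<close> (\<open>bspline_sum_Suc\<close>); induction on the degree then replaces all of them.

  For the norm, the B-splines are nonnegative with sum \<open>1\<close>, so the operator norm is at most
  \<open>sup\<^sub>i \<parallel>\<lambda>\<^sub>i*\<parallel>\<^sub>1\<close>, and \<open>\<parallel>\<lambda>\<^sub>i*\<parallel>\<^sub>1 = 1 + 2 d / ((y - x) (z - y))\<close>. Let \<open>\<alpha>\<close> and \<open>\<beta>\<close> be the extreme knots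
  averaged by \<open>y\<close>. As \<open>p \<ge> m\<close>, all knots averaged by \<open>x\<close> lie below \<open>\<alpha>\<close> and all those averaged by
  \<open>z\<close> above \<open>\<beta>\<close>, and the Bhatia--Davis inequality bounds the variance by
  \<open>(y - \<alpha>) (\<beta> - y) \<le> (y - x) (z - y)\<close>. Hence the norm is at most \<open>1 + 2 / (m - 1)\<close>.
\<close>

section \<open>Knot averages\<close>

lemma square_sum_lessThan:
  fixes g :: "nat \<Rightarrow> 'a::comm_ring_1"
  shows "(\<Sum>r<n. g r)\<^sup>2 = (\<Sum>r<n. (g r)\<^sup>2) + 2 * (\<Sum>s<n. \<Sum>r<s. g r * g s)"
proof (induction n)
  case (Suc n)
  have "(\<Sum>r<n. g r * g n) = (\<Sum>r<n. g r) * g n"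
    by (simp add: sum_distrib_right)
  with Suc.IH show ?case
    by (simp add: power2_sum algebra_simps)
qed simp

lemma real_choose_2: "real (n choose 2) = real n * (real n - 1) / 2"
  by (induction n) (simp_all add: numeral_2_eq_2 field_simps)

lemma theta_square_minus_theta_sym:
  assumes "m \<ge> 2"
  shows "(theta t m i)\<^sup>2 - theta_sym t m i 2
    = ((\<Sum>r<m. (t (i - int r))\<^sup>2) / real m - (theta t m i)\<^sup>2) / (real m - 1)"
proof -
  define P A B where "P = (\<Sum>r<m. t (i - int r))" and "A = (\<Sum>r<m. (t (i - int r))\<^sup>2)"
    and "B = (\<Sum>s<m. \<Sum>r<s. t (i - int r) * t (i - int s))"
  have B: "B = (P\<^sup>2 - A) / 2"
    using square_sum_lessThan[of "\<lambda>r. t (i - int r)" m] by (simp add: P_def A_def B_def)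
  have w: "theta_sym t m i 2 = B / (real m * (real m - 1) / 2)"
    by (simp add: theta_sym_def B_def real_choose_2)
  have y: "theta t m i = P / real m"
    by (simp add: theta_def P_def)
  have "real m > 0" "real m - 1 > 0"
    using assms by auto
  then show ?thesis
    unfolding w y B A_def[symmetric] by (simp add: divide_simps) algebra
qed

lemma theta_sym_le_theta_square:
  assumes "m \<ge> 2"
  shows "theta_sym t m i 2 \<le> (theta t m i)\<^sup>2"
proof -
  have "(\<Sum>r<m. t (i - int r))\<^sup>2 \<le> (\<Sum>r<m. (t (i - int r))\<^sup>2) * real m"
    using sum_squared_le_sum_of_squares[of "\<lambda>r. t (i - int r)" "{..<m}"] by simp
  then have "(theta t m i)\<^sup>2 \<le> (\<Sum>r<m. (t (i - int r))\<^sup>2) / real m"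
    using assms by (simp add: theta_def divide_simps power2_eq_square)
  then have "0 \<le> (theta t m i)\<^sup>2 - theta_sym t m i 2"
    unfolding theta_square_minus_theta_sym[OF assms] using assms by simp
  then show ?thesis by simp
qed

lemma theta_le:
  assumes "m > 0" "\<And>r. r < m \<Longrightarrow> t (i - int r) \<le> b"
  shows "theta t m i \<le> b"
  using sum_bounded_above[of "{..<m}" "\<lambda>r. t (i - int r)" b] assms
  by (simp add: theta_def divide_simps mult.commute)

lemma theta_ge:
  assumes "m > 0" "\<And>r. r < m \<Longrightarrow> a \<le> t (i - int r)"
  shows "a \<le> theta t m i"
  using sum_bounded_below[of "{..<m}" a "\<lambda>r. t (i - int r)"] assms
  by (simp add: theta_def divide_simps mult.commute)

text \<open>
  The Bhatia--Davis inequality: values in \<open>[a, b]\<close> with mean \<open>y\<close> have variance at most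
  \<open>(y - a) (b - y)\<close>, because the sum of the nonnegative products \<open>(t - a) (b - t)\<close> is nonnegative.
\<close>

lemma theta_square_minus_theta_sym_le:
  assumes "m \<ge> 2" "\<And>r. r < m \<Longrightarrow> a \<le> t (i - int r) \<and> t (i - int r) \<le> b"
  shows "(theta t m i)\<^sup>2 - theta_sym t m i 2
    \<le> (theta t m i - a) * (b - theta t m i) / (real m - 1)"
proof -
  define y A where "y = theta t m i" and "A = (\<Sum>r<m. (t (i - int r))\<^sup>2)"
  have m: "real m > 0" using assms(1) by simp
  have P: "(\<Sum>r<m. t (i - int r)) = real m * y"
    using m by (simp add: y_def theta_def)
  have "0 \<le> (\<Sum>r<m. (t (i - int r) - a) * (b - t (i - int r)))"
    using assms(2) by (intro sum_nonneg mult_nonneg_nonneg) auto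
  also have "\<dots> = (\<Sum>r<m. (a + b) * t (i - int r) - (t (i - int r))\<^sup>2 - a * b)"
    by (rule sum.cong) (simp_all add: algebra_simps power2_eq_square)
  also have "\<dots> = (a + b) * (\<Sum>r<m. t (i - int r)) - A - real m * (a * b)"
    by (simp add: sum_subtractf sum_distrib_left A_def)
  also have "\<dots> = real m * ((a + b) * y - a * b) - A"
    unfolding P by (simp add: algebra_simps)
  finally have "A / real m \<le> (a + b) * y - a * b"
    using m by (simp add: divide_simps mult.commute)
  then have "A / real m - y\<^sup>2 \<le> (y - a) * (b - y)"
    by (simp add: algebra_simps power2_eq_square)
  then show ?thesis
    unfolding theta_square_minus_theta_sym[OF assms(1)] y_def A_def
    using assms(1) by (intro divide_right_mono) auto
qed

section \<open>B-spline sums\<close>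

lemma bspline_nonneg:
  assumes "strict_mono t"
  shows "bspline t k i x \<ge> 0"
proof (induction k arbitrary: i)
  case (Suc k)
  have lt: "t (i - int (Suc k)) < t i" "t (i - int k) < t (i + 1)"
    using assms by (auto simp: strict_mono_less)
  \<comment> \<open>Where one of the two linear factors is negative, the B-spline next to it vanishes.\<close>
  have "0 \<le> (x - t (i - int (Suc k))) / (t i - t (i - int (Suc k))) * bspline t k (i - 1) x"
  proof (cases "x < t (i - int (Suc k))")
    case True
    then have "bspline t k (i - 1) x = 0"
      using assms by (intro bspline_eq_0) (auto simp: algebra_simps)
    then show ?thesis by simp
  next
    case False
    then show ?thesis using lt(1) Suc.IH[of "i - 1"] by simp
  qed
  moreover have "0 \<le> (t (i + 1) - x) / (t (i + 1) - t (i - int k)) * bspline t k i x"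
  proof (cases "t (i + 1) \<le> x")
    case True
    then have "bspline t k i x = 0"
      using assms by (intro bspline_eq_0) auto
    then show ?thesis by simp
  next
    case False
    then show ?thesis using lt(2) Suc.IH[of i] by simp
  qed
  ultimately show ?case by simp
qed simp

lemma bspline_combination_has_sum:
  assumes "strict_mono t" "filterlim t at_top at_top" "filterlim t at_bot at_bot"
  shows "((\<lambda>i. c i * bspline t k i x)
    has_sum (\<Sum>i | bspline t k i x \<noteq> 0. c i * bspline t k i x)) UNIV"
  by (rule has_sum_finite_neutralI) (auto intro: bspline_finite_support[OF assms])

text \<open>
  One step of de Boor's algorithm. The coefficients \<open>c i\<close> and \<open>c (i + 1)\<close> are the values at
  \<open>t (i - k)\<close> and \<open>t (i + 1)\<close> of the affine function \<open>u \<mapsto> a i + u * b i\<close>, and these two values meet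
  the same B-spline of degree \<open>k\<close>, with the weights that interpolate linearly at \<open>x\<close>.
\<close>

lemma bspline_sum_Suc:
  assumes t: "strict_mono t" "filterlim t at_top at_top" "filterlim t at_bot at_bot"
    and c: "\<And>i. c i = a i + t (i - int k) * b i" "\<And>i. c (i + 1) = a i + t (i + 1) * b i"
    and S: "((\<lambda>i. (a i + x * b i) * bspline t k i x) has_sum S) UNIV"
  shows "((\<lambda>i. c i * bspline t (Suc k) i x) has_sum S) UNIV"
proof -
  define h where "h i = (x - t (i - int k)) / (t (i + 1) - t (i - int k))" for i
  define F where "F i = (c (i + 1) * h i) * bspline t k i x" for i
  obtain d where F: "(F has_sum d) UNIV"
    using bspline_combination_has_sum[OF t, of "\<lambda>i. c (i + 1) * h i" k x] by (auto simp: F_def[abs_def])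
  have F': "((\<lambda>i. F (i - 1)) has_sum d) UNIV"
    using F has_sum_reindex_bij_witness[of UNIV "\<lambda>i. i + 1" "\<lambda>i. i - 1" UNIV F "\<lambda>i. F (i - 1)" d d]
    by simp
  have "((\<lambda>i. F (i - 1) + ((a i + x * b i) * bspline t k i x + - F i)) has_sum (d + (S + - d))) UNIV"
    using F F' S by (intro has_sum_add) (auto simp: has_sum_uminus)
  moreover have "c i * bspline t (Suc k) i x
    = F (i - 1) + ((a i + x * b i) * bspline t k i x + - F i)" for i
  proof -
    have pos: "t (i + 1) - t (i - int k) > 0" using t(1) by (simp add: strict_mono_less)
    have right: "(t (i + 1) - x) / (t (i + 1) - t (i - int k)) = 1 - h i"
      using pos by (simp add: h_def field_simps)
    have "h i * (t (i + 1) - t (i - int k)) = x - t (i - int k)"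
      using pos by (simp add: h_def)
    then have interp: "a i + x * b i = c i * (1 - h i) + c (i + 1) * h i"
      unfolding c(2) c(1)[of i] by algebra
    have "i - 1 - int k = i - int (Suc k)" "i - 1 + 1 = i" by simp_all
    then have left: "h (i - 1) = (x - t (i - int (Suc k))) / (t i - t (i - int (Suc k)))"
      by (simp only: h_def)
    have step: "bspline t (Suc k) i x = h (i - 1) * bspline t k (i - 1) x
        + (1 - h i) * bspline t k i x"
      by (simp only: bspline.simps left right)
    show ?thesis
      unfolding interp step by (simp add: F_def algebra_simps)
  qed
  ultimately show ?thesis by simp
qed

lemma bspline_sum_elementary_symmetric_1:
  assumes t: "strict_mono t" "filterlim t at_top at_top" "filterlim t at_bot at_bot"
  shows "((\<lambda>i. (\<Sum>r<k. t (i - int r)) * bspline t k i x) has_sum (real k * x)) UNIV"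
proof (induction k)
  case (Suc k)
  have "((\<lambda>i. (\<Sum>r<k. t (i - int r)) * bspline t k i x + x * bspline t k i x)
      has_sum (real k * x + x * 1)) UNIV"
    by (intro has_sum_add Suc.IH has_sum_cmult_right bspline_partition_of_unity t)
  then have "((\<lambda>i. ((\<Sum>r<k. t (i - int r)) + x * 1) * bspline t k i x)
      has_sum (real (Suc k) * x)) UNIV"
    by (simp add: algebra_simps)
  then show ?case
  proof (rule bspline_sum_Suc[OF t, rotated 2])
    fix i
    show "(\<Sum>r<Suc k. t (i - int r)) = (\<Sum>r<k. t (i - int r)) + t (i - int k) * 1"
      by simp
    show "(\<Sum>r<Suc k. t (i + 1 - int r)) = (\<Sum>r<k. t (i - int r)) + t (i + 1) * 1"
      by (simp add: sum.lessThan_Suc_shift algebra_simps del: sum.lessThan_Suc)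
  qed
qed simp

lemma bspline_sum_elementary_symmetric_2:
  assumes t: "strict_mono t" "filterlim t at_top at_top" "filterlim t at_bot at_bot"
  shows "((\<lambda>i. (\<Sum>s<k. \<Sum>r<s. t (i - int r) * t (i - int s)) * bspline t k i x)
    has_sum (real (k choose 2) * x\<^sup>2)) UNIV"
proof (induction k)
  case (Suc k)
  let ?e1 = "\<lambda>k i. \<Sum>r<k. t (i - int r)"
  let ?e2 = "\<lambda>k i. \<Sum>s<k. \<Sum>r<s. t (i - int r) * t (i - int s)"
  have "((\<lambda>i. ?e2 k i * bspline t k i x + x * (?e1 k i * bspline t k i x))
      has_sum (real (k choose 2) * x\<^sup>2 + x * (real k * x))) UNIV"
    by (intro has_sum_add Suc.IH has_sum_cmult_right bspline_sum_elementary_symmetric_1 t)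
  moreover have "real (k choose 2) * x\<^sup>2 + x * (real k * x) = real (Suc k choose 2) * x\<^sup>2"
    by (simp add: numeral_2_eq_2 algebra_simps)
  ultimately have "((\<lambda>i. (?e2 k i + x * ?e1 k i) * bspline t k i x)
      has_sum (real (Suc k choose 2) * x\<^sup>2)) UNIV"
    by (simp add: distrib_right mult.assoc)
  then show ?case
  proof (rule bspline_sum_Suc[OF t, rotated 2])
    fix i
    show "?e2 (Suc k) i = ?e2 k i + t (i - int k) * ?e1 k i"
      by (simp add: sum_distrib_left mult.commute)
    have "?e2 (Suc k) (i + 1) = (\<Sum>s<k. \<Sum>r<Suc s. t (i + 1 - int r) * t (i - int s))"
      by (simp add: sum.lessThan_Suc_shift[of _ k] del: sum.lessThan_Suc)
    also have "\<dots> = (\<Sum>s<k. (\<Sum>r<s. t (i - int r) * t (i - int s)) + t (i + 1) * t (i - int s))"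
      by (simp add: sum.lessThan_Suc_shift add.commute del: sum.lessThan_Suc)
    also have "\<dots> = ?e2 k i + t (i + 1) * ?e1 k i"
      by (simp add: sum.distrib sum_distrib_left)
    finally show "?e2 (Suc k) (i + 1) = ?e2 k i + t (i + 1) * ?e1 k i" .
  qed
qed (simp add: numeral_2_eq_2)

lemma bspline_sum_theta_sym:
  assumes t: "strict_mono t" "filterlim t at_top at_top" "filterlim t at_bot at_bot"
    and m: "m \<ge> 2" and r: "r \<in> {0, 1, 2}"
  shows "((\<lambda>i. theta_sym t m i r * bspline t m i x) has_sum x ^ r) UNIV"
proof -
  consider "r = 0" | "r = 1" | "r = 2" using r by blast
  then show ?thesis
  proof cases
    case 1
    then show ?thesis using bspline_partition_of_unity[OF t] by (simp add: theta_sym_def)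
  next
    case 2
    then show ?thesis
      using has_sum_cmult_right[OF bspline_sum_elementary_symmetric_1[OF t, of m x], of "1 / real m"] m
      by (simp add: theta_sym_def theta_def)
  next
    case 3
    have "m choose 2 > 0" using m by simp
    then show ?thesis
      using has_sum_cmult_right[OF bspline_sum_elementary_symmetric_2[OF t, of m x],
          of "1 / real (m choose 2)"] 3
      by (simp add: theta_sym_def)
  qed
qed

section \<open>The Vandermonde solution\<close>

lemma sum_three_point_support:
  fixes f :: "int \<Rightarrow> 'a::comm_monoid_add"
  assumes "p > 0" "\<And>s. s \<notin> {- int p, 0, int p} \<Longrightarrow> f s = 0"
  shows "(\<Sum>s = - int p..int p. f s) = f (- int p) + f 0 + f (int p)"
proof -
  have "(\<Sum>s = - int p..int p. f s) = sum f {- int p, 0, int p}"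
    by (rule sum.mono_neutral_right) (use assms in auto)
  also have "\<dots> = f (- int p) + f 0 + f (int p)"
    using assms(1) by (simp add: add.assoc)
  finally show ?thesis .
qed

lemma lambda_star_solution:
  assumes "strict_mono t" "m > 0" "p > 0"
  shows "vandermonde_solution t m p i (lambda_star t m p i)"
  unfolding lambda_star_def by (rule theI'[OF vandermonde_solution_ex1[OF assms]])

lemma vandermonde_solution_feasible:
  assumes "p > 0" "vandermonde_solution t m p i v"
  shows "feasible t m p i v"
proof -
  note v = assms(2)[unfolded vandermonde_solution_def]
  have "(\<Sum>s = - int p..int p. v s * theta t m (i + s) ^ r)
    = v (- int p) * theta t m (i - int p) ^ r + v 0 * theta t m i ^ r
      + v (int p) * theta t m (i + int p) ^ r" for r
    using sum_three_point_support[OF assms(1), of "\<lambda>s. v s * theta t m (i + s) ^ r"] v by simp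
  moreover have "v \<in> coeff_vectors p"
    using v by (auto simp: coeff_vectors_def)
  ultimately show ?thesis
    using v by (auto simp: feasible_def theta_sym_def mult.commute)
qed

lemma vandermonde_solution_cases:
  assumes "strict_mono t" "m \<ge> 2" "p > 0" "vandermonde_solution t m p i v"
  shows "v (- int p) \<le> 0" "v 0 \<ge> 0" "v (int p) \<le> 0"
    "norm1 p v = 1 + 2 * (((theta t m i)\<^sup>2 - theta_sym t m i 2)
      / ((theta t m i - theta t m (i - int p)) * (theta t m (i + int p) - theta t m i)))"
proof -
  define x y z w where "x = theta t m (i - int p)" "y = theta t m i"
    "z = theta t m (i + int p)" "w = theta_sym t m i 2"
  note xyzw = this
  define a b c where "a = v (- int p)" "b = v 0" "c = v (int p)"
  note abc = this
  have lt: "x < y" "y < z"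
    using theta_strict_mono[OF assms(1), of m] assms(2,3) by (auto simp: xyzw strict_mono_less)
  have w: "w \<le> y\<^sup>2"
    using theta_sym_le_theta_square[OF assms(2)] by (simp add: xyzw)
  have sys: "a + b + c = 1" "x * a + y * b + z * c = y" "x\<^sup>2 * a + y\<^sup>2 * b + z\<^sup>2 * c = w"
    using assms(4) by (simp_all add: vandermonde_solution_def xyzw abc)
  have a: "a * ((y - x) * (z - x)) = w - y\<^sup>2" and c: "c * ((z - x) * (z - y)) = w - y\<^sup>2"
    using sys by algebra+
  have "a \<le> 0"
  proof (rule ccontr)
    assume "\<not> a \<le> 0"
    then have "a * ((y - x) * (z - x)) > 0" using lt by simp
    with a w show False by simp
  qed
  moreover have "c \<le> 0"
  proof (rule ccontr)
    assume "\<not> c \<le> 0"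
    then have "c * ((z - x) * (z - y)) > 0" using lt by simp
    with c w show False by simp
  qed
  ultimately have signs: "a \<le> 0" "b \<ge> 0" "c \<le> 0" using sys(1) by linarith+
  then show "v (- int p) \<le> 0" "v 0 \<ge> 0" "v (int p) \<le> 0" by (simp_all add: abc)
  have "(z - x) * ((a + c) * ((y - x) * (z - y))) = (z - x) * (w - y\<^sup>2)"
    using a c by algebra
  then have "(a + c) * ((y - x) * (z - y)) = w - y\<^sup>2" using lt by simp
  then have "a + c = (w - y\<^sup>2) / ((y - x) * (z - y))" using lt by (simp add: nonzero_eq_divide_eq)
  moreover have "(w - y\<^sup>2) / ((y - x) * (z - y)) = - ((y\<^sup>2 - w) / ((y - x) * (z - y)))"
    by (metis minus_diff_eq minus_divide_left)
  moreover have "norm1 p v = \<bar>a\<bar> + \<bar>b\<bar> + \<bar>c\<bar>"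
    using sum_three_point_support[OF assms(3), of "\<lambda>s. \<bar>v s\<bar>"] assms(4)
    by (simp add: norm1_def vandermonde_solution_def abc)
  ultimately show "norm1 p v = 1 + 2 * (((theta t m i)\<^sup>2 - theta_sym t m i 2)
      / ((theta t m i - theta t m (i - int p)) * (theta t m (i + int p) - theta t m i)))"
    using signs sys(1) unfolding xyzw[symmetric] by linarith
qed

lemma norm1_vandermonde_solution_le:
  assumes "strict_mono t" "m \<ge> 2" "p \<ge> m" "vandermonde_solution t m p i v"
  shows "norm1 p v \<le> (real m + 1) / (real m - 1)"
proof -
  define x y z where "x = theta t m (i - int p)" "y = theta t m i" "z = theta t m (i + int p)"
  note xyz = this
  define a b where "a = t (i - int m + 1)" "b = t i"
  note ab = this
  have lt: "x < y" "y < z"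
    using theta_strict_mono[OF assms(1), of m] assms(2,3) by (auto simp: xyz strict_mono_less)
  have mono: "mono t" using assms(1) by (rule strict_mono_mono)
  have knots: "a \<le> t (i - int r) \<and> t (i - int r) \<le> b" if "r < m" for r
    using that unfolding ab by (auto intro!: monoD[OF mono])
  have "x \<le> a"
    unfolding xyz ab by (rule theta_le) (use assms in \<open>auto intro!: monoD[OF mono]\<close>)
  moreover have "b \<le> z"
    unfolding xyz ab by (rule theta_ge) (use assms in \<open>auto intro!: monoD[OF mono]\<close>)
  moreover have "a \<le> y" "y \<le> b"
    unfolding xyz(2) using knots assms(2) by (auto intro!: theta_le theta_ge)
  ultimately have "(y - a) * (b - y) \<le> (y - x) * (z - y)"
    by (intro mult_mono) auto
  then have "(y - a) * (b - y) / (real m - 1) \<le> (y - x) * (z - y) / (real m - 1)"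
    using assms(2) by (intro divide_right_mono) auto
  moreover have "y\<^sup>2 - theta_sym t m i 2 \<le> (y - a) * (b - y) / (real m - 1)"
    unfolding xyz by (rule theta_square_minus_theta_sym_le[where a = a and b = b and t = t and i = i, OF assms(2) knots])
  ultimately have "y\<^sup>2 - theta_sym t m i 2 \<le> (y - x) * (z - y) / (real m - 1)"
    by simp
  then have "(y\<^sup>2 - theta_sym t m i 2) / ((y - x) * (z - y)) \<le> 1 / (real m - 1)"
    using lt by (simp add: pos_divide_le_eq)
  then have "norm1 p v \<le> 1 + 2 * (1 / (real m - 1))"
    using vandermonde_solution_cases(4)[OF assms(1,2) _ assms(4)] assms(2,3)
    unfolding xyz by linarith
  also have "\<dots> = (real m + 1) / (real m - 1)"
    using assms(2) by (simp add: field_simps)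
  finally show ?thesis .
qed

section \<open>Optimality by duality\<close>

text \<open>
  Weak duality with a complementary slackness condition: the coefficients \<open>c0, c1, c2\<close> of a
  polynomial bounded by \<open>1\<close> at the nodes are multipliers for the three constraints.
\<close>

lemma norm1_le_by_duality:
  assumes q: "\<And>s. s \<in> {- int p..int p} \<Longrightarrow>
      \<bar>c0 + c1 * theta t m (i + s) + c2 * (theta t m (i + s))\<^sup>2\<bar> \<le> 1"
    and v: "feasible t m p i v"
    and slack: "\<And>s. s \<in> {- int p..int p} \<Longrightarrow>
      v s * (c0 + c1 * theta t m (i + s) + c2 * (theta t m (i + s))\<^sup>2) = \<bar>v s\<bar>"
    and u: "feasible t m p i u"
  shows "norm1 p v \<le> norm1 p u"
proof -
  let ?q = "\<lambda>s. c0 + c1 * theta t m (i + s) + c2 * (theta t m (i + s))\<^sup>2"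
  have pairing: "(\<Sum>s = - int p..int p. f s * ?q s)
      = c0 * theta_sym t m i 0 + c1 * theta_sym t m i 1 + c2 * theta_sym t m i 2"
    if "feasible t m p i f" for f
  proof -
    have "(\<Sum>s = - int p..int p. f s * theta t m (i + s) ^ r) = theta_sym t m i r"
      if "r \<in> {0, 1, 2}" for r
      using \<open>feasible t m p i f\<close> that unfolding feasible_def by blast
    from this[of 0, symmetric] this[of 1, symmetric] this[of 2, symmetric] show ?thesis
      by (simp add: sum_distrib_left sum.distrib distrib_left mult_ac)
  qed
  have "norm1 p v = (\<Sum>s = - int p..int p. v s * ?q s)"
    unfolding norm1_def by (rule sum.cong) (simp_all add: slack)
  also have "\<dots> = (\<Sum>s = - int p..int p. u s * ?q s)"
    unfolding pairing[OF v] pairing[OF u] ..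
  also have "\<dots> \<le> norm1 p u"
    unfolding norm1_def
  proof (rule sum_mono)
    fix s assume "s \<in> {- int p..int p}"
    then have "\<bar>u s\<bar> * \<bar>?q s\<bar> \<le> \<bar>u s\<bar>" using q by (intro mult_left_le) auto
    then show "u s * ?q s \<le> \<bar>u s\<bar>" by (metis abs_ge_self abs_mult order_trans)
  qed
  finally show ?thesis .
qed

text \<open>
  The polynomial here takes the value \<open>1\<close> at \<open>y\<close> and at its reflection \<open>x + z - y\<close>, and \<open>-1\<close> at
  \<open>x\<close> and \<open>z\<close>.
\<close>

lemma dual_quadratic_bounded:
  fixes x y z u :: real
  assumes "x < y" "y < z" "x \<le> u" "u \<le> z"
    and outside: "0 \<le> (u - y) * (u - (x + z - y))"
  shows "\<bar>1 - 2 / ((y - x) * (z - y)) * ((u - y) * (u - (x + z - y)))\<bar> \<le> 1"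
proof -
  define D where "D = (y - x) * (z - y)"
  define e where "e = (u - y) * (u - (x + z - y))"
  have D: "D > 0" using assms(1,2) by (simp add: D_def)
  have "(u - x) * (z - u) \<ge> 0" using assms(3,4) by simp
  moreover have "D - e = (u - x) * (z - u)" by (simp add: D_def e_def algebra_simps)
  ultimately have "e \<le> D" by linarith
  then have "2 / D * e \<le> 2" using D by (simp add: pos_divide_le_eq)
  moreover have "2 / D * e \<ge> 0" using D outside by (simp add: e_def)
  ultimately show ?thesis unfolding D_def[symmetric] e_def[symmetric] by linarith
qed

lemma vandermonde_solution_optimal:
  assumes "strict_mono t" "m \<ge> 2" "p > 0" and v: "vandermonde_solution t m p i v"
    and low: "theta t m (i - 1) + theta t m i \<le> theta t m (i - int p) + theta t m (i + int p)"
    and upp: "theta t m (i - int p) + theta t m (i + int p) \<le> theta t m i + theta t m (i + 1)"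
  shows "local_optimal t m p i v"
proof -
  define x y z where "x = theta t m (i - int p)" "y = theta t m i" "z = theta t m (i + int p)"
  note xyz = this
  define K where "K = 2 / ((y - x) * (z - y))"
  have sm: "strict_mono (theta t m)" using theta_strict_mono assms(1,2) by simp
  then have mono: "mono (theta t m)" by (rule strict_mono_mono)
  have lt: "x < y" "y < z" using sm assms(3) by (auto simp: xyz strict_mono_less)
  define c0 c1 c2 where "c0 = 1 - K * (y * (x + z - y))" "c1 = K * (x + z)" "c2 = - K"
  then have expand: "c0 + c1 * u + c2 * u\<^sup>2 = 1 - K * ((u - y) * (u - (x + z - y)))" for u
    by (simp add: algebra_simps power2_eq_square)
  have bounded: "\<bar>c0 + c1 * theta t m (i + s) + c2 * (theta t m (i + s))\<^sup>2\<bar> \<le> 1"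
    if s: "s \<in> {- int p..int p}" for s
  proof -
    define u where "u = theta t m (i + s)"
    have bounds: "x \<le> u" "u \<le> z"
      using s unfolding xyz u_def by (auto intro!: monoD[OF mono])
    have "0 \<le> (u - y) * (u - (x + z - y))"
    proof -
      consider "s \<le> -1" | "s = 0" | "s \<ge> 1" by linarith
      then show ?thesis
      proof cases
        case 1
        then have "u \<le> theta t m (i - 1)" "u \<le> y"
          unfolding u_def xyz by (auto intro!: monoD[OF mono])
        then show ?thesis using low unfolding xyz[symmetric] by (intro mult_nonpos_nonpos) auto
      next
        case 2
        then show ?thesis by (simp add: u_def xyz)
      next
        case 3
        then have "theta t m (i + 1) \<le> u" "y \<le> u"
          unfolding u_def xyz by (auto intro!: monoD[OF mono])
        then show ?thesis using upp unfolding xyz[symmetric] by (intro mult_nonneg_nonneg) auto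
      qed
    qed
    with dual_quadratic_bounded[OF lt bounds] show ?thesis
      unfolding u_def[symmetric] expand K_def by blast
  qed
  have at_ends: "c0 + c1 * u + c2 * u\<^sup>2 = -1" if "u \<in> {x, z}" for u
  proof -
    have "(u - y) * (u - (x + z - y)) = (y - x) * (z - y)" using that by (auto simp: algebra_simps)
    then show ?thesis using lt by (simp add: expand K_def)
  qed
  have slack: "v s * (c0 + c1 * theta t m (i + s) + c2 * (theta t m (i + s))\<^sup>2) = \<bar>v s\<bar>" for s
  proof -
    consider "s = - int p" | "s = 0" | "s = int p" | "s \<notin> {- int p, 0, int p}" by blast
    then show ?thesis
    proof cases
      case 1
      then have "theta t m (i + s) = x" by (simp add: xyz)
      with 1 vandermonde_solution_cases(1)[OF assms(1-3) v] show ?thesis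
        by (simp add: at_ends)
    next
      case 2
      then have "theta t m (i + s) = y" by (simp add: xyz)
      with 2 vandermonde_solution_cases(2)[OF assms(1-3) v] show ?thesis
        by (simp add: expand)
    next
      case 3
      then have "theta t m (i + s) = z" by (simp add: xyz)
      with 3 vandermonde_solution_cases(3)[OF assms(1-3) v] show ?thesis
        by (simp add: at_ends)
    next
      case 4
      then show ?thesis using v by (simp add: vandermonde_solution_def)
    qed
  qed
  have "feasible t m p i v" by (rule vandermonde_solution_feasible[OF assms(3) v])
  then show ?thesis
    using norm1_le_by_duality[OF bounded _ slack]
    unfolding local_optimal_def is_arg_min_def by (meson not_less)
qed

section \<open>The operator\<close>

lemma poly_degree_le_2:
  fixes q :: "'a::comm_semiring_1 poly"
  assumes "degree q \<le> 2"
  shows "poly q x = coeff q 0 + coeff q 1 * x + coeff q 2 * x\<^sup>2"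
proof -
  have "poly q x = (\<Sum>r\<le>2. coeff q r * x ^ r)"
    unfolding poly_altdef
    by (rule sum.mono_neutral_left) (use assms in \<open>auto simp: not_le coeff_eq_0\<close>)
  then show ?thesis by (simp add: numeral_2_eq_2)
qed

lemma mu_star_eq_sum:
  assumes "strict_mono t" "m > 0" "p > 0"
  shows "mu_star t m p i f
    = (\<Sum>s = - int p..int p. lambda_star t m p i s * f (theta t m (i + s)))"
  using sum_three_point_support[OF assms(3), of "\<lambda>s. lambda_star t m p i s * f (theta t m (i + s))"]
    lambda_star_solution[OF assms, of i]
  by (simp add: mu_star_def vandermonde_solution_def)

lemma Q_star_eq_dqi:
  assumes "strict_mono t" "m > 0" "p > 0"
  shows "Q_star t m p = dqi t m p (lambda_star t m p)"
  by (intro ext) (simp add: Q_star_def dqi_def mu_star_eq_sum[OF assms])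

lemma Q_star_exact_deg2:
  assumes t: "strict_mono t" "filterlim t at_top at_top" "filterlim t at_bot at_bot"
    and m: "m \<ge> 2" and p: "p > 0"
  shows "exact_deg2 (Q_star t m p)"
  unfolding exact_deg2_def
proof (intro allI impI ext)
  fix q :: "real poly" and x
  assume q: "degree q \<le> 2"
  have m0: "m > 0" using m by simp
  have mu: "mu_star t m p i (poly q) = coeff q 0 * theta_sym t m i 0
      + coeff q 1 * theta_sym t m i 1 + coeff q 2 * theta_sym t m i 2" for i
  proof -
    have "feasible t m p i (lambda_star t m p i)"
      by (rule vandermonde_solution_feasible[OF p lambda_star_solution[OF t(1) m0 p]])
    then have "(\<Sum>s = - int p..int p. lambda_star t m p i s * theta t m (i + s) ^ r)
        = theta_sym t m i r" if "r \<in> {0, 1, 2}" for r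
      using that unfolding feasible_def by blast
    from this[of 0, symmetric] this[of 1, symmetric] this[of 2, symmetric] show ?thesis
      by (simp add: mu_star_eq_sum[OF t(1) m0 p] poly_degree_le_2[OF q] sum_distrib_left
          sum.distrib distrib_left mult_ac)
  qed
  have "((\<lambda>i. coeff q 0 * (theta_sym t m i 0 * bspline t m i x)
      + coeff q 1 * (theta_sym t m i 1 * bspline t m i x)
      + coeff q 2 * (theta_sym t m i 2 * bspline t m i x))
      has_sum (coeff q 0 * x ^ 0 + coeff q 1 * x ^ 1 + coeff q 2 * x ^ 2)) UNIV"
    by (intro has_sum_add has_sum_cmult_right bspline_sum_theta_sym[OF t m]) auto
  then have "((\<lambda>i. mu_star t m p i (poly q) * bspline t m i x) has_sum poly q x) UNIV"
    by (simp add: mu poly_degree_le_2[OF q] distrib_right mult.assoc)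
  then show "Q_star t m p (poly q) x = poly q x"
    unfolding Q_star_def by (rule infsumI)
qed

lemma abs_bspline_combination_le:
  assumes t: "strict_mono t" "filterlim t at_top at_top" "filterlim t at_bot at_bot"
    and c: "\<And>i. \<bar>c i\<bar> \<le> C"
  shows "\<bar>\<Sum>\<^sub>\<infinity>i. c i * bspline t k i x\<bar> \<le> C"
proof -
  let ?J = "{i. bspline t k i x \<noteq> 0}"
  have one: "(\<Sum>i\<in>?J. bspline t k i x) = 1"
    using has_sum_unique[OF bspline_combination_has_sum[OF t, of "\<lambda>_. 1"]]
      bspline_partition_of_unity[OF t] by simp
  have "\<bar>\<Sum>\<^sub>\<infinity>i. c i * bspline t k i x\<bar> = \<bar>\<Sum>i\<in>?J. c i * bspline t k i x\<bar>"
    using infsumI[OF bspline_combination_has_sum[OF t]] by metis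
  also have "\<dots> \<le> (\<Sum>i\<in>?J. C * bspline t k i x)"
  proof (rule order_trans[OF sum_abs sum_mono])
    show "\<bar>c i * bspline t k i x\<bar> \<le> C * bspline t k i x" for i
      using c[of i] bspline_nonneg[OF t(1), of k i x] by (simp add: abs_mult mult_right_mono)
  qed
  also have "\<dots> = C" by (simp add: sum_distrib_left[symmetric] one)
  finally show ?thesis .
qed

lemma op_sup_norm_le:
  assumes "\<And>f x. (\<And>u. \<bar>f u\<bar> \<le> 1) \<Longrightarrow> \<bar>Q f x\<bar> \<le> C"
  shows "op_sup_norm Q \<le> ereal C"
  unfolding op_sup_norm_def
proof (rule SUP_least)
  fix f :: "real \<Rightarrow> real"
  assume "f \<in> {f. continuous_on UNIV f \<and> bounded (range f) \<and> sup_norm f \<le> 1}"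
  then have "sup_norm f \<le> 1" by blast
  then have "\<bar>f u\<bar> \<le> 1" for u
    unfolding sup_norm_def by (simp add: SUP_le_iff)
  then show "sup_norm (Q f) \<le> ereal C"
    unfolding sup_norm_def by (intro SUP_least) (simp add: assms)
qed

lemma op_sup_norm_Q_star_le:
  assumes t: "strict_mono t" "filterlim t at_top at_top" "filterlim t at_bot at_bot"
    and m: "m \<ge> 2" and p: "p \<ge> m"
  shows "op_sup_norm (Q_star t m p) \<le> ereal ((real m + 1) / (real m - 1))"
proof (rule op_sup_norm_le)
  fix f :: "real \<Rightarrow> real" and x
  assume f: "\<And>u. \<bar>f u\<bar> \<le> 1"
  have pos: "m > 0" "p > 0" using m p by simp_all
  have "\<bar>mu_star t m p i f\<bar> \<le> (real m + 1) / (real m - 1)" for i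
  proof -
    have "\<bar>mu_star t m p i f\<bar> \<le> norm1 p (lambda_star t m p i)"
      unfolding mu_star_eq_sum[OF t(1) pos] norm1_def
      by (rule order_trans[OF sum_abs sum_mono]) (simp add: abs_mult mult_left_le f)
    also have "\<dots> \<le> (real m + 1) / (real m - 1)"
      by (rule norm1_vandermonde_solution_le[OF t(1) m p lambda_star_solution[OF t(1) pos]])
    finally show ?thesis .
  qed
  then show "\<bar>Q_star t m p f x\<bar> \<le> (real m + 1) / (real m - 1)"
    unfolding Q_star_def by (rule abs_bspline_combination_le[OF t])
qed

theorem theorem6:
  fixes t :: "int \<Rightarrow> real" and m p :: nat
  assumes "strict_mono t"
    and "filterlim t at_top at_top"
    and "filterlim t at_bot at_bot"
    and "m \<ge> 2"
    and "p \<ge> m"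
    and "\<And>i. theta t m (i - 1) + theta t m i \<le> theta t m (i - int p) + theta t m (i + int p)"
    and "\<And>i. theta t m (i - int p) + theta t m (i + int p) \<le> theta t m i + theta t m (i + 1)"
  shows "(\<forall>i. local_optimal t m p i (lambda_star t m p i)) \<and>
    near_best t m p (lambda_star t m p) (Q_star t m p) \<and>
    op_sup_norm (Q_star t m p) \<le> ereal ((real m + 1) / (real m - 1))"
proof -
  have pos: "m > 0" "p > 0" using assms(4,5) by simp_all
  have "local_optimal t m p i (lambda_star t m p i)" for i
    by (rule vandermonde_solution_optimal[OF assms(1,4) pos(2)
          lambda_star_solution[OF assms(1) pos] assms(6,7)])
  then show ?thesis
    using Q_star_eq_dqi[OF assms(1) pos] Q_star_exact_deg2[OF assms(1-4) pos(2)]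
      op_sup_norm_Q_star_le[OF assms(1-5)]
    unfolding near_best_def by blast
qed

end
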